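(* Let $q\ge 2$ and $n\ge 2q-1$ be integers. Then $h(n,\bmod q)$ exists and $h(n,\bmod q)\le g(q(n-4)+4)$: every set of at least $g(q(n-4)+4)$ points in the plane in general position contains a convex $n$-gon with vertices in the set such that the number of points of the set in its interior is divisible by $q$.
   Context: A finite planar point set is in general position if no three of its points are collinear. $g(n)$ is the least positive integer such that every planar set in general position with at least $g(n)$ points contains $n$ points in convex position. For integers $n\ge3$, $q\ge 2$, $h(n,\bmod q)$ is the least positive integer (if it exists) such that every planar set $\mathcal X$ in general position with at least $h(n,\bmod q)$ points contains a convex $n$-gon $C$ with vertices in $\mathcal X$ such that the number of points of $\mathcal X$ in the interior of $C$ is congruent to $0$ modulo $q$ (zero interior points is allowed).
   Formalization: For n = 3, q = 2 the stated bound g(q(n-4)+4) = g(2) = 2 is false (two points contain no triangle); in this single case the bound proved is g(4) instead, n-4 being read as max(n-4, 0). *)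

theory Defs
  imports "HOL-Analysis.Analysis"
begin

type_synonym point = "real ^ 2"

definition general_position :: "point set \<Rightarrow> bool" where
  "general_position X \<longleftrightarrow>
     (\<forall>a\<in>X. \<forall>b\<in>X. \<forall>c\<in>X. a \<noteq> b \<and> a \<noteq> c \<and> b \<noteq> c \<longrightarrow> \<not> collinear {a, b, c})"

definition convex_position :: "point set \<Rightarrow> bool" where
  "convex_position C \<longleftrightarrow> (\<forall>p\<in>C. p \<notin> convex hull (C - {p}))"

definition g :: "nat \<Rightarrow> nat" where
  "g n = (LEAST k. 0 < k \<and> (\<forall>X::point set. finite X \<and> general_position X \<and> card X \<ge> k \<longrightarrow>
            (\<exists>C\<subseteq>X. card C = n \<and> convex_position C)))"

definition interior_count :: "point set \<Rightarrow> point set \<Rightarrow> nat" where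
  "interior_count X C = card (X \<inter> interior (convex hull C))"

definition h_mod_prop :: "nat \<Rightarrow> nat \<Rightarrow> nat \<Rightarrow> bool" where
  "h_mod_prop n q k \<longleftrightarrow>
     (\<forall>X::point set. finite X \<and> general_position X \<and> card X \<ge> k \<longrightarrow>
        (\<exists>C\<subseteq>X. card C = n \<and> convex_position C \<and> q dvd interior_count X C))"

definition h_mod :: "nat \<Rightarrow> nat \<Rightarrow> nat" where
  "h_mod n q = (LEAST k. 0 < k \<and> h_mod_prop n q k)"

end

(* Let excess X S be the number of points of X in the hull of S other than vertices; for a convex
   polygon S in general position this is the number of interior points. If v is a vertex of S, then
   by the anti-exchange property of hulls some point x of X in the ear cut off at v spans, with
   S - {v}, a hull containing no further point of X: replacing v by x changes the excess
   as if v had been cut off, but keeps the number of vertices.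

   A convex (q(n-4)+4)-gon contains q consecutive pieces of a fan, each with n-2 vertices, and two
   spare vertices. By the pigeonhole principle on prefix sums, consecutive pieces have union P with
   excess divisible by q; nearest points beyond the two bounding diagonals of P are free
   vertices, which makes at least n vertices. As long as there are m > n vertices, m >= 2q, so
   there are q pairwise nonadjacent ears, and a nonempty set of them has weight sum divisible by q:
   cut one of them and replace the tips of the others.

   Existence of g is Ramsey's theorem for triples coloured by orientation. *)
theory Submission
  imports Defs "HOL-Library.Ramsey"
begin

section \<open>Convex hulls\<close>

definition separates :: "'a::euclidean_space set \<Rightarrow> 'a set \<Rightarrow> 'a set \<Rightarrow> bool" where
  "separates D B C \<longleftrightarrow> (\<forall>b\<in>B. \<forall>c\<in>C. closed_segment b c \<inter> D \<noteq> {})"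

lemma separates_sym: "separates D B C \<longleftrightarrow> separates D C B"
  unfolding separates_def by (metis closed_segment_commute)

text \<open>Seen from \<open>c\<close>, this is \<open>D\<close> together with the region hidden
  behind it. Points of \<open>D\<close> met on the way to \<open>x\<close> and to \<open>y\<close>,
  at parameters \<open>s\<close> and \<open>t\<close>, are combined with weights proportional to
  \<open>\<alpha> / s\<close> and \<open>\<beta> / t\<close>; the result lies on the segment from
  \<open>c\<close> to the combination of \<open>x\<close> and \<open>y\<close>.\<close>

lemma convex_shadow:
  fixes D :: "'a::euclidean_space set"
  assumes "convex D"
  shows "convex {k. closed_segment k c \<inter> D \<noteq> {}}"
proof (rule convexI, unfold mem_Collect_eq)
  fix x y :: 'a and \<alpha> \<beta> :: real
  assume x: "closed_segment x c \<inter> D \<noteq> {}" and y: "closed_segment y c \<inter> D \<noteq> {}"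
    and ab: "0 \<le> \<alpha>" "0 \<le> \<beta>" "\<alpha> + \<beta> = 1"
  obtain s where s: "0 \<le> s" "s \<le> 1" "(1 - s) *\<^sub>R c + s *\<^sub>R x \<in> D"
    using x by (auto simp: closed_segment_commute[of x] in_segment)
  obtain t where t: "0 \<le> t" "t \<le> 1" "(1 - t) *\<^sub>R c + t *\<^sub>R y \<in> D"
    using y by (auto simp: closed_segment_commute[of y] in_segment)
  show "closed_segment (\<alpha> *\<^sub>R x + \<beta> *\<^sub>R y) c \<inter> D \<noteq> {}"
  proof (cases "s = 0 \<or> t = 0")
    case True
    then have "c \<in> D" using s t by auto
    then show ?thesis by auto
  next
    case False
    with s t have st: "s > 0" "t > 0" by auto
    \<comment> \<open>\<open>w\<close> normalises the two weights to sum 1. The combined point sits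
      at parameter \<open>1 / w\<close> from \<open>c\<close>, so \<open>w\<close> must be at least
      1 for it to stay on the segment.\<close>
    define w where "w = \<alpha> / s + \<beta> / t"
    have "\<alpha> / s \<ge> \<alpha>" "\<beta> / t \<ge> \<beta>"
      using st s t ab by (simp_all add: le_divide_eq mult_left_le)
    then have w: "w \<ge> 1" unfolding w_def using ab by linarith
    define a b where "a = \<alpha> / s / w" and "b = \<beta> / t / w"
    have "a + b = w / w" unfolding a_def b_def w_def by (simp only: add_divide_distrib)
    then have a: "a \<ge> 0" "b \<ge> 0" "a + b = 1"
      using w ab st by (auto simp: a_def b_def)
    have as: "a * s = \<alpha> / w" "b * t = \<beta> / w"
      using st by (auto simp: a_def b_def)
    have "a * (1 - s) + b * (1 - t) = 1 - (a * s + b * t)"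
      using a by (simp add: algebra_simps)
    also have "a * s + b * t = 1 / w" using as ab by (simp flip: add_divide_distrib)
    finally have c: "a * (1 - s) + b * (1 - t) = 1 - 1 / w" .
    have "a *\<^sub>R ((1 - s) *\<^sub>R c + s *\<^sub>R x) + b *\<^sub>R ((1 - t) *\<^sub>R c + t *\<^sub>R y)
        = (a * (1 - s) + b * (1 - t)) *\<^sub>R c + (a * s) *\<^sub>R x + (b * t) *\<^sub>R y"
      by (simp add: scaleR_add_right scaleR_add_left)
    also have "\<dots> = (1 - 1 / w) *\<^sub>R c + (1 / w) *\<^sub>R (\<alpha> *\<^sub>R x + \<beta> *\<^sub>R y)"
      unfolding c as by (simp add: scaleR_add_right)
    finally have "(1 - 1 / w) *\<^sub>R c + (1 / w) *\<^sub>R (\<alpha> *\<^sub>R x + \<beta> *\<^sub>R y) \<in> D"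
      using convexD[OF assms s(3) t(3) a] by simp
    moreover have "(1 - 1 / w) *\<^sub>R c + (1 / w) *\<^sub>R (\<alpha> *\<^sub>R x + \<beta> *\<^sub>R y)
        \<in> closed_segment c (\<alpha> *\<^sub>R x + \<beta> *\<^sub>R y)"
      using w unfolding in_segment by (intro exI[of _ "1 / w"]) auto
    ultimately show ?thesis by (metis closed_segment_commute disjoint_iff)
  qed
qed

text \<open>For a fixed endpoint on one side the shadow of \<open>D\<close> is convex, hence
  contains the hull of the other side. This is applied once to each side.\<close>

lemma separates_hull:
  fixes D :: "'a::euclidean_space set"
  assumes "convex D" "separates D B C"
  shows "separates D (convex hull B) (convex hull C)"
proof -
  have 1: "separates D (convex hull S) T" if "separates D S T" for S T
    unfolding separates_def
  proof (intro ballI)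
    fix k t assume k: "k \<in> convex hull S" and t: "t \<in> T"
    have "convex hull S \<subseteq> {k. closed_segment k t \<inter> D \<noteq> {}}"
      by (rule hull_minimal) (use that t convex_shadow[OF assms(1)] in \<open>auto simp: separates_def\<close>)
    then show "closed_segment k t \<inter> D \<noteq> {}" using k by blast
  qed
  show ?thesis using 1 assms(2) separates_sym by metis
qed

text \<open>A segment between the two hulls splits at a point of \<open>D\<close> into one part in
  each hull, so the union is already convex. A common point \<open>x\<close> gives the degenerate
  segment from \<open>x\<close> to \<open>x\<close>, which must meet \<open>D\<close>.\<close>

lemma separates_hull_Un_Int:
  fixes D :: "'a::euclidean_space set"
  assumes "convex D" "separates D B C" "D \<subseteq> convex hull B" "D \<subseteq> convex hull C"
  shows "convex hull (B \<union> C) = convex hull B \<union> convex hull C"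
    and "convex hull B \<inter> convex hull C = D"
proof -
  let ?K = "convex hull B" and ?L = "convex hull C"
  have sep: "\<And>k l. k \<in> ?K \<Longrightarrow> l \<in> ?L \<Longrightarrow> closed_segment k l \<inter> D \<noteq> {}"
    using separates_hull[OF assms(1,2)] unfolding separates_def by blast
  show "?K \<inter> ?L = D"
  proof
    show "?K \<inter> ?L \<subseteq> D"
    proof
      fix x assume "x \<in> ?K \<inter> ?L"
      then have "closed_segment x x \<inter> D \<noteq> {}" using sep by blast
      then show "x \<in> D" by simp
    qed
  qed (use assms in auto)
  have mix: "closed_segment k l \<subseteq> ?K \<union> ?L" if kl: "k \<in> ?K" "l \<in> ?L" for k l
  proof -
    obtain z where z: "z \<in> closed_segment k l" "z \<in> D" using sep[OF kl] by blast
    have "closed_segment k l = closed_segment k z \<union> closed_segment z l"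
      using Un_closed_segment z(1) by metis
    moreover have "closed_segment k z \<subseteq> ?K"
      using kl(1) z(2) assms(3) by (intro closed_segment_subset) auto
    moreover have "closed_segment z l \<subseteq> ?L"
      using kl(2) z(2) assms(4) by (intro closed_segment_subset) auto
    ultimately show ?thesis by blast
  qed
  have "convex (?K \<union> ?L)"
  proof (rule convex_contains_segment[THEN iffD2], intro ballI)
    fix a b assume "a \<in> ?K \<union> ?L" "b \<in> ?K \<union> ?L"
    then consider "a \<in> ?K" "b \<in> ?K" | "a \<in> ?L" "b \<in> ?L" | "a \<in> ?K" "b \<in> ?L" | "b \<in> ?K" "a \<in> ?L"
      by blast
    then show "closed_segment a b \<subseteq> ?K \<union> ?L"
    proof cases
      case 1
      then have "closed_segment a b \<subseteq> ?K" by (intro closed_segment_subset) auto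
      then show ?thesis by blast
    next
      case 2
      then have "closed_segment a b \<subseteq> ?L" by (intro closed_segment_subset) auto
      then show ?thesis by blast
    next
      case 3
      then show ?thesis by (rule mix)
    next
      case 4
      from mix[OF this] show ?thesis by (simp add: closed_segment_commute)
    qed
  qed
  then show "convex hull (B \<union> C) = ?K \<union> ?L"
    by (intro equalityI hull_minimal Un_least hull_mono) (auto simp: hull_inc)
qed

section \<open>Anti-exchange and nearest points\<close>

lemma in_hull_insert:
  fixes A :: "'a::euclidean_space set"
  assumes "A \<noteq> {}" "y \<in> convex hull (insert x A)"
  shows "\<exists>u a. 0 \<le> u \<and> u \<le> 1 \<and> a \<in> convex hull A \<and> y = u *\<^sub>R x + (1 - u) *\<^sub>R a"
proof -
  obtain a where a: "a \<in> convex hull A" "y \<in> closed_segment x a"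
    using assms by (auto simp: convex_hull_insert_segments)
  then have "y \<in> closed_segment a x" by (simp add: closed_segment_commute)
  then obtain u where "0 \<le> u" "u \<le> 1" "y = (1 - u) *\<^sub>R a + u *\<^sub>R x"
    unfolding in_segment by blast
  then show ?thesis using a(1) by (metis add.commute)
qed

text \<open>Substituting the expression of \<open>y\<close> through \<open>x\<close> into that of
  \<open>x\<close> through \<open>y\<close> gives a linear equation for \<open>x\<close>. Unless
  \<open>u = 1\<close>, which means \<open>y = x\<close>, it can be solved and shows
  \<open>x\<close> as a convex combination of \<open>a\<close> and \<open>b\<close>, both in the
  hull of \<open>A\<close>.\<close>

lemma convex_hull_antiexchange:
  fixes A :: "'a::euclidean_space set"
  assumes "x \<notin> convex hull A"
    and "y \<in> convex hull (insert x A)" "x \<in> convex hull (insert y A)"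
  shows "x = y"
proof (cases "A = {}")
  case True
  then show ?thesis using assms by simp
next
  case False
  obtain u a where u: "0 \<le> u" "u \<le> 1" "a \<in> convex hull A" "y = u *\<^sub>R x + (1 - u) *\<^sub>R a"
    using in_hull_insert[OF False assms(2)] by metis
  obtain v b where v: "0 \<le> v" "v \<le> 1" "b \<in> convex hull A" "x = v *\<^sub>R y + (1 - v) *\<^sub>R b"
    using in_hull_insert[OF False assms(3)] by metis
  show ?thesis
  proof (cases "u = 1")
    case True
    then show ?thesis using u by simp
  next
    case False
    then have uv: "v * u < 1"
      using mult_left_le_one_le[of u v] u(1,2) v(1,2) by linarith
    define w where "w = 1 - v * u"
    have w: "w > 0" using uv by (simp add: w_def)
    have "v *\<^sub>R y + (1 - v) *\<^sub>R b = (v * u) *\<^sub>R x + (v * (1 - u)) *\<^sub>R a + (1 - v) *\<^sub>R b"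
      unfolding u(4) by (simp add: scaleR_add_right)
    then have *: "x = (v * u) *\<^sub>R x + (v * (1 - u)) *\<^sub>R a + (1 - v) *\<^sub>R b"
      using v(4) by metis
    have "w *\<^sub>R x = x - (v * u) *\<^sub>R x" by (simp add: w_def scaleR_diff_left)
    also have "\<dots> = (v * (1 - u)) *\<^sub>R a + (1 - v) *\<^sub>R b"
      by (subst (1) *) simp
    finally have "w *\<^sub>R x = (v * (1 - u)) *\<^sub>R a + (1 - v) *\<^sub>R b" .
    then have "(1 / w) *\<^sub>R (w *\<^sub>R x) = (1 / w) *\<^sub>R ((v * (1 - u)) *\<^sub>R a + (1 - v) *\<^sub>R b)"
      by simp
    then have "x = (v * (1 - u) / w) *\<^sub>R a + ((1 - v) / w) *\<^sub>R b"
      using w by (simp add: scaleR_add_right)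
    moreover have "v * (1 - u) / w + (1 - v) / w = 1"
    proof -
      have "v * (1 - u) + (1 - v) = w" by (simp add: w_def algebra_simps)
      then show ?thesis using w by (metis add_divide_distrib divide_self less_numeral_extra(3))
    qed
    ultimately have "x \<in> convex hull A"
      using convexD[OF convex_convex_hull u(3) v(3)] u(1,2) v(1,2) w by simp
    then show ?thesis using assms by simp
  qed
qed

text \<open>A point of the ear minimizing the number of points of the new hull works, by anti-exchange.\<close>
lemma exists_nearest_ear_point:
  fixes A X :: "'a::euclidean_space set"
  assumes X: "finite X" "v \<in> X" "v \<notin> convex hull A"
  obtains x where "x \<in> X" "x \<in> convex hull (insert v A)" "x \<notin> convex hull A"
    "X \<inter> convex hull (insert x A) = insert x (X \<inter> convex hull A)"
proof -
  define E where "E = X \<inter> (convex hull (insert v A) - convex hull A)"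
  define c where "c x = card (X \<inter> convex hull (insert x A))" for x
  have "v \<in> E" using assms by (auto simp: E_def hull_inc)
  then obtain x where x: "x \<in> E" "\<And>y. y \<in> E \<Longrightarrow> c x \<le> c y"
    using ex_has_least_nat[of "\<lambda>x. x \<in> E" v c] by blast
  have "X \<inter> convex hull (insert x A) \<subseteq> insert x (X \<inter> convex hull A)"
  proof
    fix y assume y: "y \<in> X \<inter> convex hull (insert x A)"
    show "y \<in> insert x (X \<inter> convex hull A)"
    proof (rule ccontr)
      assume n: "y \<notin> insert x (X \<inter> convex hull A)"
      have sub: "convex hull (insert y A) \<subseteq> convex hull (insert x A)"
        using y by (intro hull_minimal) (auto simp: hull_inc)
      have "convex hull (insert x A) \<subseteq> convex hull (insert v A)"
        using x(1) by (intro hull_minimal) (auto simp: hull_inc E_def)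
      then have "y \<in> E" using y n by (auto simp: E_def)
      have "x \<notin> convex hull (insert y A)"
        using convex_hull_antiexchange[of x A y] x y n by (auto simp: E_def)
      then have "X \<inter> convex hull (insert y A) \<subset> X \<inter> convex hull (insert x A)"
        using sub x(1) by (auto simp: E_def hull_inc)
      then have "c y < c x" unfolding c_def using X by (intro psubset_card_mono) auto
      then show False using x(2)[OF \<open>y \<in> E\<close>] by simp
    qed
  qed
  moreover have "X \<inter> convex hull (insert x A) \<supseteq> insert x (X \<inter> convex hull A)"
    using x(1) hull_mono[of A "insert x A" convex] by (auto simp: E_def hull_inc)
  ultimately show thesis using x(1) that unfolding E_def by blast
qed

section \<open>Ears over a common core\<close>

definition pairwise_separated :: "'a::euclidean_space set \<Rightarrow> 'a set \<Rightarrow> bool" where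
  "pairwise_separated D I \<longleftrightarrow> (\<forall>u\<in>I. \<forall>v\<in>I. u \<noteq> v \<longrightarrow> closed_segment u v \<inter> D \<noteq> {})"

text \<open>A segment with an endpoint in \<open>A\<close> meets the core hull trivially, so only
  the segments from \<open>v\<close> to the other tips matter.\<close>

lemma separates_ears:
  assumes "pairwise_separated (convex hull A) (insert v J)" "v \<notin> J"
  shows "separates (convex hull A) (A \<union> J) (insert v A)"
  unfolding separates_def
proof (intro ballI)
  fix b c assume b: "b \<in> A \<union> J" and c: "c \<in> insert v A"
  show "closed_segment b c \<inter> convex hull A \<noteq> {}"
  proof (cases "b \<in> A \<or> c \<in> A")
    case True
    then show ?thesis using hull_inc[of _ A convex] by (metis disjoint_iff ends_in_segment)
  next
    case False
    then have "b \<in> insert v J" "c \<in> insert v J" "b \<noteq> c" using b c assms(2) by auto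
    then show ?thesis using assms(1) unfolding pairwise_separated_def by blast
  qed
qed

text \<open>The ear at \<open>v\<close> is glued to the polygon carrying all other ears, along the
  hull of the core \<open>A\<close>.\<close>

lemma ears_hull:
  assumes "pairwise_separated (convex hull A) (insert v J)" "v \<notin> J"
  shows "convex hull (A \<union> insert v J) = convex hull (A \<union> J) \<union> convex hull (insert v A)"
    and "convex hull (A \<union> J) \<inter> convex hull (insert v A) = convex hull A"
proof -
  have "A \<union> insert v J = (A \<union> J) \<union> insert v A" by auto
  then show "convex hull (A \<union> insert v J) = convex hull (A \<union> J) \<union> convex hull (insert v A)"
    using separates_hull_Un_Int(1)[OF convex_convex_hull separates_ears[OF assms]]
    by (simp add: hull_mono subset_insertI)
  show "convex hull (A \<union> J) \<inter> convex hull (insert v A) = convex hull A"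
    using separates_hull_Un_Int(2)[OF convex_convex_hull separates_ears[OF assms]]
    by (simp add: hull_mono subset_insertI)
qed

section \<open>Replacing ears\<close>

text \<open>Integer valued, so that differences are not truncated.\<close>

definition excess :: "'a::euclidean_space set \<Rightarrow> 'a set \<Rightarrow> int" where
  "excess X S = int (card (X \<inter> convex hull S)) - int (card S)"

lemma int_card_Un_Int:
  "finite S \<Longrightarrow> finite T \<Longrightarrow> int (card (S \<union> T)) = int (card S) + int (card T) - int (card (S \<inter> T))"
  using card_Un_Int[of S T] by simp

text \<open>The ears overlap only in the core hull, so inclusion-exclusion lets each ear contribute
  its own weight, independently of the others.\<close>

lemma excess_ears:
  assumes X: "finite X" and fin: "finite J" "finite A"
    and "pairwise_separated (convex hull A) J" "A \<inter> J = {}"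
  shows "excess X (A \<union> J) = excess X A + (\<Sum>v\<in>J. excess X (insert v A) - excess X A)"
  using fin(1) assms(4,5)
proof (induction J rule: finite_induct)
  case empty
  then show ?case by simp
next
  case (insert v J)
  let ?c = "\<lambda>S. int (card (X \<inter> convex hull S))"
  have IH: "excess X (A \<union> J) = excess X A + (\<Sum>v\<in>J. excess X (insert v A) - excess X A)"
    using insert by (auto simp: pairwise_separated_def)
  have "?c (A \<union> insert v J) = int (card ((X \<inter> convex hull (A \<union> J)) \<union> (X \<inter> convex hull (insert v A))))"
    unfolding ears_hull(1)[OF insert.prems(1) insert.hyps(2)] by (simp add: Int_Un_distrib)
  also have "\<dots> = ?c (A \<union> J) + ?c (insert v A) - int (card (X \<inter> (convex hull (A \<union> J) \<inter> convex hull (insert v A))))"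
    using X by (subst int_card_Un_Int) (auto simp: Int_ac)
  finally have c: "?c (A \<union> insert v J) = ?c (A \<union> J) + ?c (insert v A) - ?c A"
    unfolding ears_hull(2)[OF insert.prems(1) insert.hyps(2)] .
  have "card (A \<union> insert v J) = Suc (card (A \<union> J))" "card (insert v A) = Suc (card A)"
    using insert fin by auto
  with c have "excess X (A \<union> insert v J) = excess X (A \<union> J) + excess X (insert v A) - excess X A"
    unfolding excess_def by simp
  then show ?case using IH insert.hyps by simp
qed

lemma convex_position_extreme:
  assumes "finite S" "convex_position S"
  shows "x extreme_point_of (convex hull S) \<longleftrightarrow> x \<in> S"
  using assms by (intro extreme_point_of_convex_hull_convex_independent finite_imp_compact)
    (auto simp: convex_position_def)

lemma convex_position_subset:
  "convex_position S \<Longrightarrow> T \<subseteq> S \<Longrightarrow> convex_position T"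
  unfolding convex_position_def by (meson Diff_mono hull_mono in_mono order_refl)

text \<open>All ears are cut; the tips in \<open>K\<close> are then replaced by nearest points of
  their ears, while those in \<open>I - K\<close> are lost. A proper subset \<open>K\<close> lowers
  the number of vertices at unchanged excess.\<close>

lemma replace_ears:
  fixes X :: "point set"
  assumes X: "finite X" "A \<union> I \<subseteq> X" and conv: "convex_position (A \<union> I)" and dis: "A \<inter> I = {}"
    and pw: "pairwise_separated (convex hull A) I" and K: "K \<subseteq> I"
  obtains S where "S \<subseteq> X" "convex_position S" "card S = card A + card K" "excess X S = excess X A"
proof -
  have fin: "finite A" "finite I" "finite K"
    using X K by (meson finite_subset Un_subset_iff)+
  have "\<exists>x. x \<in> X \<and> x \<in> convex hull (insert v A) \<and> x \<notin> convex hull A \<and>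
      X \<inter> convex hull (insert x A) = insert x (X \<inter> convex hull A)" if "v \<in> I" for v
  proof -
    have "A \<subseteq> A \<union> I - {v}" "v \<in> A \<union> I" using that dis by auto
    then have "v \<notin> convex hull A" using conv hull_mono unfolding convex_position_def by (metis subsetD)
    moreover have "v \<in> X" using that X by auto
    ultimately show ?thesis using exists_nearest_ear_point[OF X(1)] by metis
  qed
  then obtain f where f: "\<And>v. v \<in> I \<Longrightarrow> f v \<in> X"
    "\<And>v. v \<in> I \<Longrightarrow> f v \<in> convex hull (insert v A)" "\<And>v. v \<in> I \<Longrightarrow> f v \<notin> convex hull A"
    "\<And>v. v \<in> I \<Longrightarrow> X \<inter> convex hull (insert (f v) A) = insert (f v) (X \<inter> convex hull A)"
    by metis
  have fA: "f v \<notin> A" if "v \<in> I" for v using f(3)[OF that] hull_inc by metis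
  \<comment> \<open>The new tips lie in the old ears, and separation of the old tips extends to
    their whole ears by \<open>separates_hull\<close>.\<close>
  have meet: "closed_segment (f u) (f v) \<inter> convex hull A \<noteq> {}" if "u \<in> I" "v \<in> I" "u \<noteq> v" for u v
  proof -
    have "pairwise_separated (convex hull A) (insert v {u})"
      using pw that unfolding pairwise_separated_def by blast
    then have "separates (convex hull A) (insert u A) (insert v A)"
      using separates_ears[of A v "{u}"] that by simp
    from separates_hull[OF convex_convex_hull this] show ?thesis
      using f(2) that unfolding separates_def by blast
  qed
  have inj: "inj_on f I"
  proof (rule inj_onI, rule ccontr)
    fix u v assume uv: "u \<in> I" "v \<in> I" "f u = f v" "u \<noteq> v"
    then have "f u \<in> convex hull A" using meet[of u v] by simp
    then show False using f(3) uv by blast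
  qed
  have pwf: "pairwise_separated (convex hull A) (f ` I)"
    unfolding pairwise_separated_def using meet by auto
  define S where "S = A \<union> f ` K"
  have AS: "A \<inter> f ` K = {}" using fA K by auto
  have "S \<subseteq> X" using X f(1) K by (auto simp: S_def)
  moreover have "card S = card A + card K"
    unfolding S_def using fin AS card_image[OF inj_on_subset[OF inj K]] by (simp add: card_Un_disjoint)
  moreover have "excess X S = excess X A"
  proof -
    \<comment> \<open>Over the core, the new ear adds one point of \<open>X\<close>, and that point
      is also the one added vertex.\<close>
    have one: "excess X (insert (f v) A) - excess X A = 0" if "v \<in> K" for v
      using f(3)[of v] f(4)[of v] fA[of v] that K fin X unfolding excess_def by auto
    have "pairwise_separated (convex hull A) (f ` K)"
      using pwf K unfolding pairwise_separated_def by blast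
    then have "excess X S = excess X A + (\<Sum>v\<in>f ` K. excess X (insert v A) - excess X A)"
      unfolding S_def using fin X AS by (intro excess_ears) auto
    also have "(\<Sum>v\<in>f ` K. excess X (insert v A) - excess X A) = 0"
      using one by (intro sum.neutral) auto
    finally show ?thesis by simp
  qed
  moreover have "convex_position S"
    unfolding convex_position_def
  proof
    fix p assume "p \<in> S"
    then consider "p \<in> A" | v where "v \<in> K" "p = f v" by (auto simp: S_def)
    then show "p \<notin> convex hull (S - {p})"
    proof cases
      \<comment> \<open>A core vertex is extreme in the old hull. Removing it leaves a convex set
        that contains every other point of \<open>S\<close>.\<close>
      case 1
      let ?H = "convex hull (A \<union> I)"
      have "p extreme_point_of ?H"
        using 1 fin conv by (subst convex_position_extreme) auto
      then have "convex (?H - {p})"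
        using extreme_point_of_stillconvex[of ?H p] by simp
      moreover have "f v \<in> ?H" if "v \<in> K" for v
        using f(2)[of v] that K hull_mono[of "insert v A" "A \<union> I" convex] by auto
      then have "S - {p} \<subseteq> ?H - {p}"
        by (auto simp: S_def hull_inc)
      ultimately have "convex hull (S - {p}) \<subseteq> ?H - {p}" by (intro hull_minimal)
      then show ?thesis by blast
    next
      \<comment> \<open>If a new tip lay in the hull of the core and the other new tips, it would
        lie in the intersection of that hull with its own ear, which is the core hull;
        \<open>f\<close> avoids the core hull.\<close>
      case 2
      let ?J = "f ` (K - {v})"
      have pi: "p \<notin> ?J" using 2 inj K unfolding inj_on_def by auto
      have "pairwise_separated (convex hull A) (insert p ?J)"
        using pwf K 2 unfolding pairwise_separated_def by blast
      from ears_hull(2)[OF this pi] have "p \<in> convex hull (A \<union> ?J) \<Longrightarrow> p \<in> convex hull A"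
        using hull_inc[of p "insert p A" convex] by (metis IntI insertI1)
      then have "p \<notin> convex hull (A \<union> ?J)"
        using f(3)[of v] 2 K by (metis subsetD)
      moreover have "S - {p} \<subseteq> A \<union> ?J" using 2 by (auto simp: S_def)
      ultimately show ?thesis using hull_mono by (metis subsetD)
    qed
  qed
  ultimately show thesis using that by blast
qed

section \<open>Orientation and cyclic order\<close>

text \<open>Twice the signed area of the triangle, positive exactly for counterclockwise
  order.\<close>

definition orient :: "point \<Rightarrow> point \<Rightarrow> point \<Rightarrow> real" where
  "orient a b c = (b$1 - a$1) * (c$2 - a$2) - (b$2 - a$2) * (c$1 - a$1)"

lemma orient_eq_0_imp_collinear:
  assumes "orient a b c = 0"
  shows "collinear {a, b, c}"
proof (cases "b = a")
  case True
  then show ?thesis by (simp add: insert_commute)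
next
  case False
  have "\<exists>t. c - a = t *\<^sub>R (b - a)"
  proof (cases "b $ 1 = a $ 1")
    case True
    with False have n: "b $ 2 - a $ 2 \<noteq> 0" by (auto simp: vec_eq_iff forall_2)
    then have "c - a = ((c$2 - a$2) / (b$2 - a$2)) *\<^sub>R (b - a)"
      using assms True by (auto simp: vec_eq_iff forall_2 orient_def)
    then show ?thesis by blast
  next
    case n: False
    then have d: "b $ 1 - a $ 1 \<noteq> 0" by simp
    have "c $ 2 - a $ 2 = (b$2 - a$2) * (c$1 - a$1) / (b$1 - a$1)"
      using assms nonzero_eq_divide_eq[OF d] by (simp add: orient_def mult.commute)
    then have "c - a = ((c$1 - a$1) / (b$1 - a$1)) *\<^sub>R (b - a)"
      using d by (simp add: vec_eq_iff forall_2 mult.commute)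
    then show ?thesis by blast
  qed
  then have "collinear {0, b - a, c - a}" unfolding collinear_lemma by blast
  then have "collinear {b, a, c}" by (simp add: collinear_3)
  then show ?thesis by (simp add: insert_commute)
qed

text \<open>The affine dependence of four points in the plane. When the common weight sum is
  nonzero, dividing by it yields a point on both lines \<open>a c\<close> and
  \<open>b d\<close>.\<close>

lemma orient_relation:
  "orient b c d *\<^sub>R a + orient a b d *\<^sub>R c = orient a c d *\<^sub>R b + orient a b c *\<^sub>R d"
  "orient b c d + orient a b d = orient a c d + orient a b c"
  by (simp_all add: vec_eq_iff forall_2 orient_def algebra_simps)

text \<open>All weights in \<open>orient_relation\<close> are positive, so after division by
  \<open>s\<close> its two sides are convex combinations of the endpoints of the two
  diagonals.\<close>

lemma diagonals_cross:
  assumes "orient a b c > 0" "orient a b d > 0" "orient a c d > 0" "orient b c d > 0"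
  shows "closed_segment a c \<inter> closed_segment b d \<noteq> {}"
proof -
  define s where "s = orient b c d + orient a b d"
  have s: "s > 0" "s = orient a c d + orient a b c"
    using assms orient_relation(2)[of b c d a] by (auto simp: s_def)
  define z where "z = (1 / s) *\<^sub>R (orient b c d *\<^sub>R a + orient a b d *\<^sub>R c)"
  have "z = (1 - orient a b d / s) *\<^sub>R a + (orient a b d / s) *\<^sub>R c"
    using s(1) by (simp add: z_def s_def scaleR_add_right diff_divide_eq_iff)
  moreover have "orient a b d / s \<le> 1" using assms s by (simp add: s_def)
  ultimately have 1: "z \<in> closed_segment a c"
    using assms s unfolding in_segment by (intro exI[of _ "orient a b d / s"]) auto
  have "z = (1 / s) *\<^sub>R (orient a c d *\<^sub>R b + orient a b c *\<^sub>R d)"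
    unfolding z_def orient_relation(1) ..
  also have "\<dots> = (1 - orient a b c / s) *\<^sub>R b + (orient a b c / s) *\<^sub>R d"
    using s by (simp add: scaleR_add_right diff_divide_eq_iff)
  finally have "z = (1 - orient a b c / s) *\<^sub>R b + (orient a b c / s) *\<^sub>R d" .
  moreover have "orient a b c / s \<le> 1" using assms s by simp
  ultimately have "z \<in> closed_segment b d"
    using assms s unfolding in_segment by (intro exI[of _ "orient a b c / s"]) auto
  with 1 show ?thesis by blast
qed

text \<open>Solving \<open>orient_relation\<close> for \<open>c\<close> leaves only nonnegative
  weights. In convex position this is impossible, which extends counterclockwise order around
  \<open>a\<close> to triples avoiding \<open>a\<close>.\<close>

lemma orient_nonpos_imp_in_triangle:
  assumes "orient a b c > 0" "orient a b d > 0" "orient a c d > 0" "orient b c d \<le> 0"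
  shows "c \<in> convex hull {a, b, d}"
proof -
  define s where "s = orient a b d"
  have s: "s > 0" "s = orient a c d + orient a b c - orient b c d"
    using assms orient_relation(2)[of b c d a] by (auto simp: s_def)
  have "s *\<^sub>R c = orient a c d *\<^sub>R b + orient a b c *\<^sub>R d - orient b c d *\<^sub>R a"
    using orient_relation(1)[of b c d a] by (simp add: s_def algebra_simps)
  then have "(1 / s) *\<^sub>R (s *\<^sub>R c) = (1 / s) *\<^sub>R (orient a c d *\<^sub>R b + orient a b c *\<^sub>R d - orient b c d *\<^sub>R a)"
    by simp
  then have "c = (- orient b c d / s) *\<^sub>R a + (orient a c d / s) *\<^sub>R b + (orient a b c / s) *\<^sub>R d"
    using s(1) by (simp add: algebra_simps)
  moreover have "- orient b c d / s + orient a c d / s + orient a b c / s = 1"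
  proof -
    have "- orient b c d / s + orient a c d / s + orient a b c / s
        = (- orient b c d + orient a c d + orient a b c) / s"
      by (simp only: add_divide_distrib)
    also have "- orient b c d + orient a c d + orient a b c = s" using s(2) by linarith
    finally show ?thesis using s(1) by simp
  qed
  moreover have "- orient b c d / s \<ge> 0" "orient a c d / s \<ge> 0" "orient a b c / s \<ge> 0"
    using assms s(1) by (auto simp: divide_nonpos_pos)
  ultimately show ?thesis unfolding convex_hull_3 by blast
qed

lemma general_positionD:
  "general_position X \<Longrightarrow> a \<in> X \<Longrightarrow> b \<in> X \<Longrightarrow> c \<in> X \<Longrightarrow> a \<noteq> b \<Longrightarrow> a \<noteq> c \<Longrightarrow> b \<noteq> c \<Longrightarrow>
    \<not> collinear {a, b, c}"
  unfolding general_position_def by simp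

section \<open>Cyclic enumeration of a convex polygon\<close>

lemma finite_sort_by_key:
  fixes key :: "'a \<Rightarrow> real"
  assumes "finite S" "inj_on key S"
  shows "\<exists>f. bij_betw f {..<card S} S \<and> (\<forall>i j. i < j \<longrightarrow> j < card S \<longrightarrow> key (f i) < key (f j))"
proof -
  define L where "L = sorted_list_of_set (key ` S)"
  have L: "set L = key ` S" "distinct L" "length L = card S" "sorted_wrt (<) L"
    using assms by (auto simp: L_def card_image)
  define f where "f i = the_inv_into S key (L ! i)" for i
  have "bij_betw ((!) L) {..<card S} (key ` S)"
    using bij_betw_nth[OF L(2)] L by auto
  then have "bij_betw f {..<card S} S"
    using bij_betw_trans[OF _ bij_betw_the_inv_into[OF inj_on_imp_bij_betw[OF assms(2)]]]
    unfolding f_def comp_def by blast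
  moreover have "key (f i) = L ! i" if "i < card S" for i
  proof -
    have "L ! i \<in> key ` S" using that L(3) nth_mem[of i L] unfolding L(1) by simp
    then show ?thesis unfolding f_def by (rule f_the_inv_into_f[OF assms(2)])
  qed
  then have "key (f i) < key (f j)" if "i < j" "j < card S" for i j
    using that L(3,4) by (simp add: sorted_wrt_iff_nth_less)
  ultimately show ?thesis by blast
qed

text \<open>A line separates one vertex \<open>o'\<close> from the others, so these lie in an open
  half plane as seen from \<open>o'\<close> and can be sorted by angle. Triples with
  \<open>o'\<close> are then counterclockwise by sorting, all others by convex position.\<close>

lemma ccw_enumeration:
  assumes fin: "finite C" and conv: "convex_position C" and gp: "general_position C"
  obtains p where "bij_betw p {..<card C} C"
    "\<And>i j k. i < j \<Longrightarrow> j < k \<Longrightarrow> k < card C \<Longrightarrow> orient (p i) (p j) (p k) > 0"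
proof (cases "C = {}")
  case True
  then show thesis using that[of undefined] by (simp add: bij_betw_def)
next
  case False
  then obtain o' where o: "o' \<in> C" by blast
  define C' where "C' = C - {o'}"
  have "o' \<notin> convex hull C'" using conv o by (auto simp: convex_position_def C'_def)
  moreover have "closed (convex hull C')"
    using fin by (simp add: C'_def compact_imp_closed compact_convex_hull finite_imp_compact)
  ultimately obtain u b where ub: "u \<bullet> o' < b" "\<And>x. x \<in> convex hull C' \<Longrightarrow> u \<bullet> x > b"
    using separating_hyperplane_closed_point[of "convex hull C'" o'] by auto
  \<comment> \<open>Up to a common factor, \<open>h\<close> and \<open>w\<close> are coordinates
    relative to \<open>o'\<close> along \<open>u\<close> and perpendicular to it. Since
    \<open>h\<close> is positive on \<open>C'\<close>, \<open>key\<close> is the tangent of the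
    angle measured from \<open>u\<close>.\<close>
  define h where "h x = u$1 * (x$1 - o'$1) + u$2 * (x$2 - o'$2)" for x :: point
  define w where "w x = u$1 * (x$2 - o'$2) - u$2 * (x$1 - o'$1)" for x :: point
  define key where "key x = w x / h x" for x
  have h: "h x > 0" if "x \<in> C'" for x
  proof -
    have "u \<bullet> x > u \<bullet> o'" using ub that hull_inc[of x C' convex] by fastforce
    then show ?thesis by (simp add: h_def inner_vec_def sum_2 algebra_simps)
  qed
  have rel: "h x * w y - w x * h y = ((u$1)\<^sup>2 + (u$2)\<^sup>2) * orient o' x y" for x y
    by (simp add: h_def w_def orient_def algebra_simps power2_eq_square)
  have key: "key x < key y \<longleftrightarrow> orient o' x y > 0" if "x \<in> C'" "y \<in> C'" for x y
  proof -
    have "u \<noteq> 0" using h[OF that(1)] by (auto simp: h_def)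
    then have "u$1 \<noteq> 0 \<or> u$2 \<noteq> 0" by (auto simp: vec_eq_iff forall_2)
    then have pos: "(u$1)\<^sup>2 + (u$2)\<^sup>2 > 0" by (simp add: sum_power2_gt_zero_iff)
    have "key x < key y \<longleftrightarrow> w x * h y < w y * h x"
      unfolding key_def using h[OF that(1)] h[OF that(2)] by (simp add: pos_divide_less_eq pos_less_divide_eq)
    also have "\<dots> \<longleftrightarrow> 0 < h x * w y - w x * h y" by (simp add: mult.commute)
    finally have "key x < key y \<longleftrightarrow> 0 < h x * w y - w x * h y" .
    then show ?thesis unfolding rel using pos by (simp add: zero_less_mult_iff)
  qed
  have inj: "inj_on key C'"
  proof (rule inj_onI, rule ccontr)
    fix x y assume xy: "x \<in> C'" "y \<in> C'" "key x = key y" "x \<noteq> y"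
    have "orient o' x y = - orient o' y x" by (simp add: orient_def algebra_simps)
    then have "orient o' x y = 0" using key[of x y] key[of y x] xy by auto
    then have "collinear {o', x, y}" by (rule orient_eq_0_imp_collinear)
    moreover have "\<not> collinear {o', x, y}"
      using o xy(1,2,4) by (intro general_positionD[OF gp]) (auto simp: C'_def)
    ultimately show False by contradiction
  qed
  have "finite C'" using fin by (simp add: C'_def)
  from finite_sort_by_key[OF this inj] obtain f where f0: "bij_betw f {..<card C'} C' \<and>
      (\<forall>i j. i < j \<longrightarrow> j < card C' \<longrightarrow> key (f i) < key (f j))" ..
  have f: "bij_betw f {..<card C'} C'" "\<And>i j. i < j \<Longrightarrow> j < card C' \<Longrightarrow> key (f i) < key (f j)"
    using f0 by simp_all
  have cC: "card C = Suc (card C')" unfolding C'_def by (rule card.remove[OF fin o])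
  define p where "p i = (case i of 0 \<Rightarrow> o' | Suc j \<Rightarrow> f j)" for i
  have p: "p 0 = o'" "\<And>j. p (Suc j) = f j" by (auto simp: p_def)
  have fC: "f i \<in> C'" if "i < card C'" for i using f(1) that by (auto simp: bij_betw_def)
  have "inj_on p {..<card C}"
  proof (rule linorder_inj_onI')
    fix i j assume ij: "i \<in> {..<card C}" "j \<in> {..<card C}" "i < j"
    obtain m where m: "j = Suc m" using ij by (cases j) auto
    have fm: "f m \<in> C'" using fC ij m cC by auto
    show "p i \<noteq> p j"
    proof (cases i)
      case 0
      then show ?thesis using fm m p by (auto simp: C'_def)
    next
      case (Suc l)
      then have "key (f l) < key (f m)" using f(2)[of l m] ij m cC by auto
      then show ?thesis using Suc m p by auto
    qed
  qed
  moreover have "p ` {..<card C} = C"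
    unfolding cC lessThan_Suc_eq_insert_0 image_insert image_image p
    using f(1) o by (auto simp: bij_betw_def C'_def)
  ultimately have bij: "bij_betw p {..<card C} C" by (simp add: bij_betw_def)
  have zero: "orient o' (p j) (p k) > 0" if "0 < j" "j < k" "k < card C" for j k
    using that f(2)[of "j - 1" "k - 1"] fC key cC by (cases j; cases k) (auto simp: p)
  have "orient (p i) (p j) (p k) > 0" if ijk: "i < j" "j < k" "k < card C" for i j k
  proof (cases "i = 0")
    case True
    then show ?thesis using zero ijk p by auto
  next
    case False
    \<comment> \<open>A nonpositive triple would put \<open>p j\<close> into the triangle of
      \<open>o'\<close>, \<open>p i\<close> and \<open>p k\<close>.\<close>
    show ?thesis
    proof (rule ccontr)
      assume "\<not> ?thesis"
      then have "p j \<in> convex hull {o', p i, p k}"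
        using False ijk by (intro orient_nonpos_imp_in_triangle zero) auto
      moreover have "{o', p i, p k} \<subseteq> C - {p j}"
      proof -
        have "p 0 \<noteq> p j" "p i \<noteq> p j" "p k \<noteq> p j"
          using inj_on_contraD[OF bij_betw_imp_inj_on[OF bij]] ijk False by auto
        moreover have "p i \<in> C" "p k \<in> C" using bij ijk by (auto simp: bij_betw_def)
        ultimately show ?thesis using o p by auto
      qed
      ultimately have "p j \<in> convex hull (C - {p j})" using hull_mono by (metis subsetD)
      moreover have "p j \<in> C" using bij ijk by (auto simp: bij_betw_def)
      ultimately show False using conv by (auto simp: convex_position_def)
    qed
  qed
  then show thesis using that bij by blast
qed

text \<open>The only trace of the cyclic order that later arguments use: interleaved chords
  cross.\<close>

lemma alternating_enumeration:
  assumes "finite C" "convex_position C" "general_position C"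
  obtains p where "bij_betw p {..<card C} C"
    "\<And>i j k l. i < j \<Longrightarrow> j < k \<Longrightarrow> k < l \<Longrightarrow> l < card C \<Longrightarrow>
       closed_segment (p i) (p k) \<inter> closed_segment (p j) (p l) \<noteq> {}"
proof -
  obtain p where p: "bij_betw p {..<card C} C"
    "\<And>i j k. i < j \<Longrightarrow> j < k \<Longrightarrow> k < card C \<Longrightarrow> orient (p i) (p j) (p k) > 0"
    using ccw_enumeration[OF assms] by blast
  show thesis
    by (rule that[OF p(1)], rule diagonals_cross) (auto intro: p(2))
qed

section \<open>Interior points in general position\<close>

lemma general_position_subset: "general_position X \<Longrightarrow> Y \<subseteq> X \<Longrightarrow> general_position Y"
  unfolding general_position_def by blast

text \<open>Caratheodory's theorem in the plane; the three points may coincide.\<close>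

lemma convex_hull_member_triple:
  fixes S :: "point set"
  assumes "x \<in> convex hull S"
  obtains a b c where "a \<in> S" "b \<in> S" "c \<in> S" "x \<in> convex hull {a, b, c}"
proof -
  obtain T where T: "finite T" "T \<subseteq> S" "card T \<le> 3" "x \<in> convex hull T"
    using assms unfolding caratheodory[of S] by auto
  have "T \<noteq> {}" using T by auto
  have "card T = 1 \<or> card T = 2 \<or> card T = 3"
    using T \<open>T \<noteq> {}\<close> card_0_eq[of T] by linarith
  then obtain a b c where "T = {a, b, c}"
    by (metis card_1_singletonE card_2_iff card_3_iff insert_absorb2)
  then show thesis using that T by auto
qed

text \<open>If a barycentric weight vanished, \<open>x\<close> would lie on a segment between two
  points of \<open>S\<close>, so it would equal one of them or be collinear with both.\<close>

lemma hull_member_open_triangle: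
  assumes gp: "general_position X" and S: "S \<subseteq> X" and x: "x \<in> X" "x \<in> convex hull S" "x \<notin> S"
  obtains a b c u v w where "a \<in> S" "b \<in> S" "c \<in> S" "\<not> collinear {a, b, c}"
    "u > 0" "v > 0" "w > 0" "u + v + w = 1" "x = u *\<^sub>R a + v *\<^sub>R b + w *\<^sub>R c"
proof -
  obtain a b c where abc: "a \<in> S" "b \<in> S" "c \<in> S" "x \<in> convex hull {a, b, c}"
    using convex_hull_member_triple[OF x(2)] by blast
  have seg: False if "y \<in> S" "z \<in> S" "x \<in> closed_segment y z" for y z
  proof (cases "y = z")
    case True
    then show ?thesis using that x by auto
  next
    case False
    have "collinear {y, x, z}" using that(3) by (simp add: between_imp_collinear between_mem_segment)
    moreover have "\<not> collinear {y, x, z}"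
      using x that S False by (intro general_positionD[OF gp]) auto
    ultimately show ?thesis by contradiction
  qed
  obtain u v w where uvw: "u \<ge> 0" "v \<ge> 0" "w \<ge> 0" "u + v + w = 1" "x = u *\<^sub>R a + v *\<^sub>R b + w *\<^sub>R c"
    using abc(4) unfolding convex_hull_3 by blast
  have "u \<noteq> 0"
  proof
    assume "u = 0"
    then have "x \<in> closed_segment b c" using uvw by (auto simp: in_segment intro!: exI[of _ w])
    then show False using seg abc by blast
  qed
  moreover have "v \<noteq> 0"
  proof
    assume "v = 0"
    then have "x \<in> closed_segment a c" using uvw by (auto simp: in_segment intro!: exI[of _ w])
    then show False using seg abc by blast
  qed
  moreover have "w \<noteq> 0"
  proof
    assume "w = 0"
    then have "x \<in> closed_segment a b" using uvw by (auto simp: in_segment intro!: exI[of _ v])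
    then show False using seg abc by blast
  qed
  moreover have "\<not> collinear {a, b, c}"
  proof -
    have ne: "a \<noteq> b" "a \<noteq> c" "b \<noteq> c"
      using seg[of a c] seg[of a b] seg[of b a] abc by (auto simp: insert_absorb2 segment_convex_hull insert_commute)
    then show ?thesis using abc S by (intro general_positionD[OF gp]) auto
  qed
  ultimately have pos: "0 < u" "0 < v" "0 < w" and nc: "\<not> collinear {a, b, c}"
    using uvw by auto
  show thesis by (rule that[OF abc(1-3) nc pos uvw(4,5)])
qed

lemma in_interior_hull:
  assumes gp: "general_position X" and S: "S \<subseteq> X" and x: "x \<in> X" "x \<in> convex hull S" "x \<notin> S"
  shows "x \<in> interior (convex hull S)"
proof -
  obtain a b c u v w where abc: "a \<in> S" "b \<in> S" "c \<in> S" and nc: "\<not> collinear {a, b, c}"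
    and pos: "u > 0" "v > 0" "w > 0" and uvw: "u + v + w = 1" "x = u *\<^sub>R a + v *\<^sub>R b + w *\<^sub>R c"
    using hull_member_open_triangle[OF assms] by metis
  have "DIM(point) = 2" by simp
  from interior_convex_hull_3_minimal[OF nc this] have "x \<in> interior (convex hull {a, b, c})"
    using pos uvw(1) uvw(2)[symmetric] by blast
  moreover have "interior (convex hull {a, b, c}) \<subseteq> interior (convex hull S)"
    using abc by (intro interior_mono hull_mono) auto
  ultimately show ?thesis by blast
qed

text \<open>Vertices are extreme and hence not interior, while by general position no other point of
  \<open>X\<close> lies on the boundary.\<close>

lemma interior_count_eq_excess:
  assumes "finite X" "general_position X" "S \<subseteq> X" "convex_position S"
  shows "int (interior_count X S) = excess X S"
proof -
  have fin: "finite S" using assms finite_subset by blast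
  have "X \<inter> interior (convex hull S) = X \<inter> convex hull S - S"
  proof
    show "X \<inter> interior (convex hull S) \<subseteq> X \<inter> convex hull S - S"
    proof
      fix x assume x: "x \<in> X \<inter> interior (convex hull S)"
      then have "x \<notin> S"
        using convex_position_extreme[OF fin assms(4)] extreme_point_not_in_interior by blast
      then show "x \<in> X \<inter> convex hull S - S" using x interior_subset by blast
    qed
  next
    show "X \<inter> convex hull S - S \<subseteq> X \<inter> interior (convex hull S)"
      using in_interior_hull[OF assms(2,3)] by blast
  qed
  moreover have "S \<subseteq> X \<inter> convex hull S" using assms by (auto simp: hull_inc)
  ultimately show ?thesis
    using assms fin unfolding interior_count_def excess_def
    by (simp add: card_Diff_subset card_mono of_nat_diff)
qed

section \<open>Existence of Erdos--Szekeres numbers\<close>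

text \<open>Barycentric coordinates are ratios of signed areas. Hence a point inside a triangle sees
  its three directed sides turn the same way.\<close>

lemma orient_convex_combination:
  assumes "u + v + w = 1"
  shows "orient (u *\<^sub>R a + v *\<^sub>R b + w *\<^sub>R c) a b = w * orient a b c"
    and "orient (u *\<^sub>R a + v *\<^sub>R b + w *\<^sub>R c) b c = u * orient a b c"
    and "orient (u *\<^sub>R a + v *\<^sub>R b + w *\<^sub>R c) c a = v * orient a b c"
proof -
  have u: "u = 1 - v - w" using assms by simp
  show "orient (u *\<^sub>R a + v *\<^sub>R b + w *\<^sub>R c) a b = w * orient a b c"
    "orient (u *\<^sub>R a + v *\<^sub>R b + w *\<^sub>R c) b c = u * orient a b c"
    "orient (u *\<^sub>R a + v *\<^sub>R b + w *\<^sub>R c) c a = v * orient a b c"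
    unfolding u orient_def by (simp_all add: algebra_simps)
qed

lemma orient_swap: "orient a c b = - orient a b c"
  and orient_rotate: "orient b c a = orient a b c"
  by (simp_all add: orient_def algebra_simps)

text \<open>The sign of \<open>s\<close> covers both orientation classes. If \<open>e j\<close> were
  inside a triangle of other points, its vertices would follow each other cyclically in one turning
  direction around \<open>e j\<close>. Homogeneity makes turning around \<open>e j\<close> a linear
  order, which admits no such cycle.\<close>

lemma homogeneous_imp_convex_position:
  fixes e :: "nat \<Rightarrow> point" and s :: real
  assumes gp: "general_position (e ` H)" and inj: "inj_on e H"
    and or: "\<And>i j k. i \<in> H \<Longrightarrow> j \<in> H \<Longrightarrow> k \<in> H \<Longrightarrow> i < j \<Longrightarrow> j < k \<Longrightarrow> s * orient (e i) (e j) (e k) > 0"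
    and fin: "finite H"
  shows "convex_position (e ` H)"
  unfolding convex_position_def
proof (intro ballI notI)
  fix x assume "x \<in> e ` H" and hull: "x \<in> convex hull (e ` H - {x})"
  then obtain j where j: "j \<in> H" "x = e j" by blast
  obtain a b c u v w where abc: "a \<in> e ` H - {x}" "b \<in> e ` H - {x}" "c \<in> e ` H - {x}"
    and nc: "\<not> collinear {a, b, c}"
    and pos: "u > 0" "v > 0" "w > 0" and uvw: "u + v + w = 1" "x = u *\<^sub>R a + v *\<^sub>R b + w *\<^sub>R c"
    using hull_member_open_triangle[OF gp _ _ hull] j by blast
  obtain ia ib ic where i: "a = e ia" "b = e ib" "c = e ic" "ia \<in> H - {j}" "ib \<in> H - {j}" "ic \<in> H - {j}"
    using abc j by blast
  obtain R where R: "\<And>i. i \<in> H \<Longrightarrow> i < R" using fin finite_nat_bounded by blast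
  \<comment> \<open>Position in the cyclic order starting after \<open>j\<close>: indices below
    \<open>j\<close> are moved behind all larger ones, since \<open>R\<close> exceeds every index in
    \<open>H\<close>.\<close>
  define r where "r i = (if j < i then i else i + R)" for i
  have ord: "s * orient (e j) (e k) (e l) > 0" if "k \<in> H - {j}" "l \<in> H - {j}" "r k < r l" for k l
  proof (cases "j < k")
    case True
    show ?thesis
    proof (cases "j < l")
      case l: True
      then show ?thesis using that or j True by (simp add: r_def)
    next
      case l: False
      then have "s * orient (e l) (e j) (e k) > 0" using that or[of l j k] j True by auto
      then show ?thesis using orient_rotate[of "e j" "e k" "e l"] by metis
    qed
  next
    case False
    then have kl: "k < l" "l < j" using that R[of l] by (auto simp: r_def split: if_splits)
    then have "s * orient (e k) (e l) (e j) > 0" using that or[of k l j] j by auto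
    then show ?thesis using orient_rotate[of "e k" "e l" "e j"] orient_rotate[of "e l" "e j" "e k"] by metis
  qed
  have r_le: "r k \<le> r l" if "k \<in> H - {j}" "l \<in> H - {j}" "s * orient (e j) (e k) (e l) > 0" for k l
  proof (rule ccontr)
    assume "\<not> ?thesis"
    then have "s * orient (e j) (e l) (e k) > 0" using ord that by simp
    then show False using that(3) by (simp add: orient_swap[of "e j" "e l" "e k"])
  qed
  have r_inj: "r k \<noteq> r l" if "k \<in> H - {j}" "l \<in> H - {j}" "k \<noteq> l" for k l
    using that R[of k] R[of l] by (auto simp: r_def)
  have "ia \<noteq> ib"
  proof
    assume "ia = ib"
    then have "{a, b, c} = {a, c}" using i by simp
    then show False using nc by simp
  qed
  \<comment> \<open>The three turns around \<open>e j\<close> are positive multiples of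
    \<open>\<Delta>\<close>, so its sign decides the direction of the cycle.\<close>
  define \<Delta> where "\<Delta> = s * orient a b c"
  have D: "s * orient (e j) (e ia) (e ib) = w * \<Delta>" "s * orient (e j) (e ib) (e ic) = u * \<Delta>"
    "s * orient (e j) (e ic) (e ia) = v * \<Delta>"
    using orient_convex_combination[OF uvw(1), of a b c] i j uvw(2)
    by (simp_all add: \<Delta>_def)
  have sw: "s * orient (e j) (e ib) (e ia) = w * - \<Delta>" "s * orient (e j) (e ic) (e ib) = u * - \<Delta>"
    "s * orient (e j) (e ia) (e ic) = v * - \<Delta>"
    using D by (simp_all add: orient_swap[of "e j" "e ib" "e ia"] orient_swap[of "e j" "e ic" "e ib"]
      orient_swap[of "e j" "e ia" "e ic"])
  have "\<Delta> \<noteq> 0"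
  proof (cases "r ia < r ib")
    case True
    then show ?thesis using ord[OF i(4,5)] D(1) by auto
  next
    case False
    then have "r ib < r ia" using r_inj[OF i(4,5) \<open>ia \<noteq> ib\<close>] by simp
    then show ?thesis using ord[OF i(5,4)] sw(1) by auto
  qed
  then consider "\<Delta> > 0" | "- \<Delta> > 0" by linarith
  then show False
  proof cases
    case 1
    then have "r ia \<le> r ib" "r ib \<le> r ic" "r ic \<le> r ia"
      using r_le i(4-6) D pos by simp_all
    then show False using r_inj[of ia ib] i(4,5) \<open>ia \<noteq> ib\<close> by simp
  next
    case 2
    then have "r ib \<le> r ia" "r ic \<le> r ib" "r ia \<le> r ic"
      using r_le i(4-6) sw pos mult_pos_pos by metis+
    then show False using r_inj[of ia ib] i(4,5) \<open>ia \<noteq> ib\<close> by simp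
  qed
qed

text \<open>The two colours are positive and nonpositive orientation. General position excludes
  zero, so a monochromatic set is homogeneous; \<open>Suc R\<close> serves as a bound that is
  certainly positive.\<close>

lemma erdos_szekeres:
  "\<exists>k>0. \<forall>X::point set. finite X \<and> general_position X \<and> card X \<ge> k \<longrightarrow>
     (\<exists>C\<subseteq>X. card C = n \<and> convex_position C)"
proof -
  obtain R :: nat where R: "partn_lst {..<R} [n, n] 3" using ramsey_full by blast
  have "\<exists>C\<subseteq>X. card C = n \<and> convex_position C"
    if X: "finite X" "general_position X" "card X \<ge> Suc R" for X :: "point set"
  proof -
    obtain e where e: "bij_betw e {0..<card X} X" using ex_bij_betw_nat_finite[OF X(1)] by blast
    \<comment> \<open>Ramsey's theorem colours unordered sets, so the colour quantifies over
      increasing triples; a three-element set has exactly one.\<close>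
    define f :: "nat set \<Rightarrow> nat" where
      "f Y = (if \<forall>i\<in>Y. \<forall>j\<in>Y. \<forall>k\<in>Y. i < j \<and> j < k \<longrightarrow> orient (e i) (e j) (e k) > 0 then 0 else 1)" for Y
    have "f \<in> nsets {..<R} 3 \<rightarrow> {..<2}" by (auto simp: f_def)
    with R obtain c H where c: "c < length [n, n]" and H: "H \<in> nsets {..<R} ([n, n] ! c)"
      and hom: "f ` nsets H 3 \<subseteq> {c}"
      by (rule partn_lstE) simp
    have c2: "c = 0 \<or> c = 1" using c by auto
    then have H: "H \<subseteq> {..<R}" "finite H" "card H = n"
      using H by (auto simp: nsets_def)
    have HX: "H \<subseteq> {0..<card X}" using H(1) X(3) by auto
    then have inj: "inj_on e H" and sub: "e ` H \<subseteq> X"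
      using e by (auto simp: bij_betw_def inj_on_subset)
    have gp: "general_position (e ` H)" using general_position_subset X sub by blast
    define s :: real where "s = (if c = 0 then 1 else - 1)"
    have "s * orient (e i) (e j) (e k) > 0" if ijk: "i \<in> H" "j \<in> H" "k \<in> H" "i < j" "j < k" for i j k
    proof -
      have "{i, j, k} \<in> nsets H 3" using ijk by (auto simp: nsets_def)
      then have fc: "f {i, j, k} = c" using hom by blast
      have val: "f {i, j, k} = (if orient (e i) (e j) (e k) > 0 then 0 else 1)"
      proof -
        have "(\<forall>a\<in>{i, j, k}. \<forall>b\<in>{i, j, k}. \<forall>c\<in>{i, j, k}. a < b \<and> b < c \<longrightarrow> orient (e a) (e b) (e c) > 0)
            \<longleftrightarrow> orient (e i) (e j) (e k) > 0"
          using ijk(4,5) by simp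
        then show ?thesis unfolding f_def by (rule if_cong) simp_all
      qed
      have "e i \<noteq> e j" "e i \<noteq> e k" "e j \<noteq> e k"
        using ijk inj_on_eq_iff[OF inj] by simp_all
      then have "\<not> collinear {e i, e j, e k}"
        using ijk by (intro general_positionD[OF gp]) auto
      then have "orient (e i) (e j) (e k) \<noteq> 0" using orient_eq_0_imp_collinear by blast
      then show ?thesis using fc val by (auto simp: s_def split: if_splits)
    qed
    then have "convex_position (e ` H)"
      by (rule homogeneous_imp_convex_position[OF gp inj _ H(2)])
    then show ?thesis using sub card_image[OF inj] H(3) by blast
  qed
  then show ?thesis by blast
qed

lemma g_spec:
  shows "g n > 0"
    and "finite X \<Longrightarrow> general_position X \<Longrightarrow> card X \<ge> g n \<Longrightarrow> \<exists>C\<subseteq>X. card C = n \<and> convex_position C"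
proof -
  from LeastI_ex[OF erdos_szekeres[of n]] have *: "g n > 0 \<and> (\<forall>X::point set. finite X \<and> general_position X \<and> card X \<ge> g n \<longrightarrow>
     (\<exists>C\<subseteq>X. card C = n \<and> convex_position C))"
    unfolding g_def .
  from * show "g n > 0" by blast
  from * show "finite X \<Longrightarrow> general_position X \<Longrightarrow> card X \<ge> g n \<Longrightarrow> \<exists>C\<subseteq>X. card C = n \<and> convex_position C"
    by blast
qed

section \<open>Polygons with divisible excess\<close>

text \<open>Pigeonhole for \<open>q + 1\<close> values and \<open>q\<close> residues. For prefix
  sums \<open>F\<close> it yields a nonempty run with sum divisible by \<open>q\<close>.\<close>

lemma exists_congruent_pair:
  fixes F :: "nat \<Rightarrow> int"
  assumes "q > 0"
  obtains i j where "i < j" "j \<le> q" "int q dvd F j - F i"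
proof -
  have "(\<lambda>i. F i mod int q) ` {..q} \<subseteq> {0..<int q}" using assms by auto
  then have "card ((\<lambda>i. F i mod int q) ` {..q}) \<le> card {0..<int q}" by (intro card_mono) auto
  then have "card ((\<lambda>i. F i mod int q) ` {..q}) < card {..q}" by simp
  from pigeonhole[OF this] obtain i j where ij: "i \<le> q" "j \<le> q" "i \<noteq> j" "F i mod int q = F j mod int q"
    unfolding inj_on_def by auto
  then have "int q dvd F j - F i" "int q dvd F i - F j" by (auto simp: mod_eq_dvd_iff[symmetric])
  then show thesis using that[of i j] that[of j i] ij by (cases "i < j") auto
qed

text \<open>Odd positions are pairwise nonadjacent, and the even positions below
  \<open>2 * q\<close> all stay in the core and supply the separating chords.\<close>

lemma odd_vertices_separated:
  assumes p: "bij_betw p {..<card S} S"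
    and alt: "\<And>i j k l. i < j \<Longrightarrow> j < k \<Longrightarrow> k < l \<Longrightarrow> l < card S \<Longrightarrow>
       closed_segment (p i) (p k) \<inter> closed_segment (p j) (p l) \<noteq> {}"
    and q: "2 * q \<le> card S" and K: "K \<subseteq> {..<q}"
  shows "pairwise_separated (convex hull (S - (\<lambda>k. p (2 * k + 1)) ` K)) ((\<lambda>k. p (2 * k + 1)) ` K)"
proof -
  let ?v = "\<lambda>k. p (2 * k + 1)" let ?A = "S - ?v ` K"
  have even: "p (2 * k) \<in> ?A" if "k < q" for k
  proof -
    have "p (2 * k) \<noteq> ?v l" if "l \<in> K" for l
    proof -
      have "l < q" using that K by auto
      moreover have "2 * k \<noteq> 2 * l + 1" by presburger
      ultimately show ?thesis
        using inj_on_contraD[OF bij_betw_imp_inj_on[OF p], of "2 * k" "2 * l + 1"] q \<open>k < q\<close> by auto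
    qed
    moreover have "p (2 * k) \<in> S" using bij_betwE[OF p] q \<open>k < q\<close> by auto
    ultimately show ?thesis by blast
  qed
  have main: "closed_segment (?v k) (?v l) \<inter> convex hull ?A \<noteq> {}" if "k \<in> K" "l \<in> K" "k < l" for k l
  proof -
    have "l < q" using that K by auto
    \<comment> \<open>The positions \<open>0 < 2 * k + 1 < 2 * k + 2 < 2 * l + 1\<close> interleave
      because \<open>k < l\<close>, and the last is below \<open>card S\<close> because
      \<open>l < q\<close>.\<close>
    have "closed_segment (p (2 * 0)) (p (2 * (k + 1))) \<inter> closed_segment (?v k) (?v l) \<noteq> {}"
      using that \<open>l < q\<close> q by (intro alt) auto
    moreover have "closed_segment (p (2 * 0)) (p (2 * (k + 1))) \<subseteq> convex hull ?A"
      using that \<open>l < q\<close> by (intro closed_segment_subset hull_inc even) auto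
    ultimately show ?thesis by blast
  qed
  show ?thesis
    unfolding pairwise_separated_def
  proof (intro ballI impI)
    fix a b assume "a \<in> ?v ` K" "b \<in> ?v ` K" "a \<noteq> b"
    then obtain k l where kl: "k \<in> K" "l \<in> K" "a = ?v k" "b = ?v l" "k \<noteq> l" by auto
    then show "closed_segment a b \<inter> convex hull ?A \<noteq> {}"
      using main[of k l] main[of l k] by (cases "k < l") (auto simp: closed_segment_commute)
  qed
qed

text \<open>Some nonempty set of alternate ears has total weight divisible by \<open>q\<close>. One of them is cut off; in
  each other one, replacing the tip by a nearest point changes the count by the same amount as cutting.\<close>
lemma remove_one_vertex:
  assumes X: "finite X" "general_position X" and S: "S \<subseteq> X" "convex_position S"
    and q: "q > 0" "2 * q \<le> card S" and dvd: "int q dvd excess X S"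
  shows "\<exists>S'\<subseteq>X. convex_position S' \<and> card S' = card S - 1 \<and> int q dvd excess X S'"
proof -
  have finS: "finite S" using X S finite_subset by blast
  obtain p where p: "bij_betw p {..<card S} S"
    and alt: "\<And>i j k l. i < j \<Longrightarrow> j < k \<Longrightarrow> k < l \<Longrightarrow> l < card S \<Longrightarrow>
       closed_segment (p i) (p k) \<inter> closed_segment (p j) (p l) \<noteq> {}"
    using alternating_enumeration[OF finS S(2) general_position_subset[OF X(2) S(1)]] by metis
  define v where "v k = p (2 * k + 1)" for k
  note sep = odd_vertices_separated[OF p alt q(2), folded v_def]
  have vS: "v k \<in> S" if "k < q" for k
    unfolding v_def using bij_betwE[OF p] that q by auto
  have vinj: "inj_on v {..<q}"
  proof (rule inj_onI)
    fix k l assume "k \<in> {..<q}" "l \<in> {..<q}" "v k = v l"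
    then show "k = l"
      using inj_onD[OF bij_betw_imp_inj_on[OF p], of "2 * k + 1" "2 * l + 1"] q by (auto simp: v_def)
  qed
  define I where "I = v ` {..<q}"
  define A where "A = S - I"
  define t where "t x = excess X (insert x A) - excess X A" for x
  have IS: "I \<subseteq> S" using vS by (auto simp: I_def)
  have finI: "finite I" "finite A" using finS by (auto simp: I_def A_def)
  have sepI: "pairwise_separated (convex hull A) I"
    unfolding A_def I_def by (rule sep) auto
  have tot: "excess X (A \<union> I') = excess X A + (\<Sum>x\<in>I'. t x)" if "I' \<subseteq> I" for I'
    unfolding t_def
  proof (rule excess_ears[OF X(1)])
    show "finite I'" "finite A" using that finI finite_subset by auto
    show "pairwise_separated (convex hull A) I'" using sepI that unfolding pairwise_separated_def by blast
    show "A \<inter> I' = {}" using that by (auto simp: A_def)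
  qed
  \<comment> \<open>Pigeonhole on prefix sums of the ear weights, measured over the core
    \<open>A\<close> with all \<open>q\<close> ears cut.\<close>
  obtain i j where ij: "i < j" "j \<le> q" "int q dvd (\<Sum>k<j. t (v k)) - (\<Sum>k<i. t (v k))"
    using exists_congruent_pair[OF q(1), of "\<lambda>i. \<Sum>k<i. t (v k)"] by metis
  define J where "J = v ` {i..<j}"
  have JI: "J \<subseteq> I" using ij by (auto simp: J_def I_def)
  have "(\<Sum>k<j. t (v k)) = (\<Sum>k<i. t (v k)) + (\<Sum>k=i..<j. t (v k))"
    using sum.atLeastLessThan_concat[of 0 i j "\<lambda>k. t (v k)"] ij by (simp add: atLeast0LessThan)
  moreover have "(\<Sum>x\<in>J. t x) = (\<Sum>k=i..<j. t (v k))"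
    unfolding J_def using ij by (subst sum.reindex) (auto intro: inj_on_subset[OF vinj])
  ultimately have qJ: "int q dvd (\<Sum>x\<in>J. t x)" using ij(3) by simp
  define B where "B = S - J"
  have "B = A \<union> (I - J)" "S = A \<union> I" using IS JI by (auto simp: A_def B_def)
  \<comment> \<open>Additivity over \<open>A\<close> compares the polygon without the ears in
    \<open>J\<close> to the full one; the difference is the weight sum of \<open>J\<close>.\<close>
  then have "excess X B = excess X A + (\<Sum>x\<in>I - J. t x)" "excess X S = excess X A + (\<Sum>x\<in>I. t x)"
    using tot[of "I - J"] tot[of I] by auto
  moreover have "(\<Sum>x\<in>I. t x) = (\<Sum>x\<in>I - J. t x) + (\<Sum>x\<in>J. t x)"
    using JI finI(1) by (rule sum.subset_diff)
  ultimately have "excess X B = excess X S - (\<Sum>x\<in>J. t x)" by simp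
  then have qB: "int q dvd excess X B" using dvd qJ by (simp add: dvd_diff)
  have BJ: "B \<union> J = S" "B \<inter> J = {}" using JI IS by (auto simp: B_def)
  have sepJ: "pairwise_separated (convex hull B) J"
    unfolding B_def J_def using ij by (intro sep) auto
  have vi: "v i \<in> J" using ij by (auto simp: J_def)
  have sub: "B \<union> J \<subseteq> X" "convex_position (B \<union> J)" using BJ S by auto
  \<comment> \<open>The run is nonempty since \<open>i < j\<close>, so \<open>v i\<close> can be the
    one tip given up; every other tip in \<open>J\<close> gets a substitute.\<close>
  obtain S' where S': "S' \<subseteq> X" "convex_position S'" "card S' = card B + card (J - {v i})" "excess X S' = excess X B"
    by (rule replace_ears[OF X(1) sub BJ(2) sepJ, of "J - {v i}"]) auto
  have finBJ: "finite B" "finite J" using finS by (auto simp: B_def J_def)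
  then have "card S = card B + card J" using card_Un_disjoint[OF _ _ BJ(2)] BJ(1) by simp
  moreover have "card (J - {v i}) = card J - 1" "card J > 0"
    using vi finBJ by (auto simp: card_gt_0_iff)
  ultimately have "card S' = card S - 1" using S'(3) by simp
  then show ?thesis using S' qB by auto
qed

text \<open>Vertices are removed one at a time. As long as more than \<open>n\<close> remain there
  are at least \<open>2 * q\<close>, enough for \<open>q\<close> nonadjacent ears.\<close>

lemma reduce_to_size:
  assumes X: "finite X" "general_position X" and S: "S \<subseteq> X" "convex_position S" "int q dvd excess X S"
    and q: "q > 0" and n: "2 * q - 1 \<le> n" "n \<le> card S"
  shows "\<exists>S'\<subseteq>X. convex_position S' \<and> card S' = n \<and> int q dvd excess X S'"
  using n(2)
proof (induction rule: inc_induct)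
  case base
  then show ?case using S by blast
next
  case (step m)
  then obtain S' where S': "S' \<subseteq> X" "convex_position S'" "card S' = Suc m" "int q dvd excess X S'" by blast
  have "2 * q \<le> card S'" using S'(3) step n(1) by simp
  from remove_one_vertex[OF X S'(1,2) q this S'(4)] show ?case using S'(3) by simp
qed

text \<open>\<open>W a b\<close> is the part of the fan from apex \<open>p 0\<close> over the
  vertices \<open>a\<close> to \<open>b\<close>. Two parts are glued along the diagonal to
  \<open>p a\<close>, whose two endpoints are counted twice both among the points and among the
  vertices, so the corrections cancel.\<close>

lemma fan_excess:
  fixes p :: "nat \<Rightarrow> point"
  assumes X: "finite X" "general_position X" and pX: "p ` {..<N} \<subseteq> X" "inj_on p {..<N}"
    and alt: "\<And>i j k l. i < j \<Longrightarrow> j < k \<Longrightarrow> k < l \<Longrightarrow> l < N \<Longrightarrow>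
       closed_segment (p i) (p k) \<inter> closed_segment (p j) (p l) \<noteq> {}"
    and W: "\<And>a b. W a b = insert (p 0) (p ` {a..b})"
    and ab: "2 \<le> a" "a \<le> b" "b < N"
  shows "excess X (W 2 b) = excess X (W 2 a) + excess X (W a b)"
proof -
  let ?D = "closed_segment (p 0) (p a)"
  have D: "?D = convex hull {p 0, p a}" by (simp add: segment_convex_hull)
  have p0a: "p 0 \<noteq> p a" "p 0 \<in> X" "p a \<in> X"
    using inj_on_contraD[OF pX(2), of 0 a] ab pX(1) by auto
  \<comment> \<open>A third point of \<open>X\<close> on the diagonal would violate general
    position.\<close>
  have XD: "X \<inter> ?D = {p 0, p a}"
  proof
    show "X \<inter> ?D \<subseteq> {p 0, p a}"
    proof (rule ccontr)
      assume "\<not> X \<inter> ?D \<subseteq> {p 0, p a}"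
      then obtain x where x: "x \<in> X" "x \<in> ?D" "x \<noteq> p 0" "x \<noteq> p a" by blast
      then have "collinear {p 0, x, p a}" by (simp add: between_imp_collinear between_mem_segment)
      moreover have "\<not> collinear {p 0, x, p a}"
        using x p0a by (intro general_positionD[OF X(2)]) auto
      ultimately show False by contradiction
    qed
  qed (use p0a in auto)
  have sep: "separates ?D (W 2 a) (W a b)"
    unfolding separates_def
  proof (intro ballI)
    fix y z assume y: "y \<in> W 2 a" and z: "z \<in> W a b"
    show "closed_segment y z \<inter> ?D \<noteq> {}"
    proof (cases "y \<in> {p 0, p a} \<or> z \<in> {p 0, p a}")
      case True
      then show ?thesis by (metis disjoint_iff ends_in_segment empty_iff insert_iff)
    next
      case False
      then obtain k l where k: "y = p k" "2 \<le> k" "k \<le> a" "z = p l" "a \<le> l" "l \<le> b"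
        using y z unfolding W by auto
      then have "k < a" "a < l" using False by (auto simp: less_le)
      then have "?D \<inter> closed_segment (p k) (p l) \<noteq> {}" using k ab by (intro alt) auto
      then show ?thesis using k by (simp add: Int_commute)
    qed
  qed
  have sub: "?D \<subseteq> convex hull (W 2 a)" "?D \<subseteq> convex hull (W a b)"
    unfolding D using ab by (intro hull_mono; auto simp: W)+
  have un: "W 2 b = W 2 a \<union> W a b"
    unfolding W using ivl_disj_un_two_touch(4)[of 2 a b] ab by auto
  have int: "W 2 a \<inter> W a b = {p 0, p a}"
  proof
    show "W 2 a \<inter> W a b \<subseteq> {p 0, p a}"
    proof
      fix x assume x: "x \<in> W 2 a \<inter> W a b"
      show "x \<in> {p 0, p a}"
      proof (cases "x = p 0")
        case False
        then have "x \<in> p ` {2..a}" "x \<in> p ` {a..b}" using x unfolding W by auto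
        then obtain k l where kl: "x = p k" "k \<le> a" "x = p l" "a \<le> l" "l \<le> b"
          by (elim imageE) auto
        then have "k = l" using inj_onD[OF pX(2), of k l] ab by auto
        then show ?thesis using kl by auto
      qed simp
    qed
  qed (use ab in \<open>auto simp: W\<close>)
  note hull = separates_hull_Un_Int[OF convex_closed_segment sep sub]
  have "int (card (X \<inter> convex hull W 2 b)) = int (card (X \<inter> convex hull W 2 a)) + int (card (X \<inter> convex hull W a b))
      - int (card ((X \<inter> convex hull W 2 a) \<inter> (X \<inter> convex hull W a b)))"
    unfolding un hull(1) Int_Un_distrib using X(1) by (intro int_card_Un_Int) auto
  moreover have "(X \<inter> convex hull W 2 a) \<inter> (X \<inter> convex hull W a b) = {p 0, p a}"
    using hull(2) XD by blast
  moreover have "int (card (W 2 b)) = int (card (W 2 a)) + int (card (W a b)) - int (card {p 0, p a})"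
    unfolding un int[symmetric] by (intro int_card_Un_Int) (auto simp: W)
  ultimately show ?thesis unfolding excess_def by simp
qed

text \<open>Cut the polygon, minus two vertices, into a fan of \<open>q\<close> consecutive \<open>(M + 2)\<close>-gons. Some run of
  them has total weight divisible by \<open>q\<close>, and each of its two bounding diagonals gains a vertex
  whose ear contains no further point.\<close>
lemma exists_large_divisible_polygon:
  assumes X: "finite X" "general_position X" and C: "C \<subseteq> X" "convex_position C" "card C = q * M + 4"
    and q: "q > 0"
  shows "\<exists>S\<subseteq>X. convex_position S \<and> M + 4 \<le> card S \<and> int q dvd excess X S"
proof -
  have finC: "finite C" using X C finite_subset by blast
  obtain p where p: "bij_betw p {..<card C} C"
    and alt: "\<And>i j k l. i < j \<Longrightarrow> j < k \<Longrightarrow> k < l \<Longrightarrow> l < card C \<Longrightarrow>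
       closed_segment (p i) (p k) \<inter> closed_segment (p j) (p l) \<noteq> {}"
    using alternating_enumeration[OF finC C(2) general_position_subset[OF X(2) C(1)]] by metis
  note inj = bij_betw_imp_inj_on[OF p]
  have pX: "p ` {..<card C} \<subseteq> X" using p C(1) by (simp add: bij_betw_def)
  define W where "W a b = insert (p 0) (p ` {a..b})" for a b
  note fan = fan_excess[OF X pX inj alt W_def]
  \<comment> \<open>The \<open>q + 1\<close> fan parts \<open>W 2 (2 + i * M)\<close> act as prefix
    sums, starting from the degenerate part \<open>W 2 2\<close>.\<close>
  obtain i j where ij: "i < j" "j \<le> q" "int q dvd excess X (W 2 (2 + j * M)) - excess X (W 2 (2 + i * M))"
    using exists_congruent_pair[OF q, of "\<lambda>i. excess X (W 2 (2 + i * M))"] by metis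
  define a b where "a = 2 + i * M" and "b = 2 + j * M"
  have "j * M \<le> q * M" using ij by simp
  moreover have "M + i * M \<le> j * M" using ij mult_le_mono1[of "Suc i" j M] by simp
  ultimately have ab: "2 \<le> a" "a \<le> b" "b + 1 < card C" "M + a \<le> b"
    unfolding C(3) a_def b_def by linarith+
  have dvd: "int q dvd excess X (W a b)"
    using ij(3) fan[of a b] ab unfolding a_def[symmetric] b_def[symmetric] by simp
  \<comment> \<open>Starting the fan at position 2 and ending it by \<open>q * M + 2\<close>
    reserves positions 1 and \<open>q * M + 3\<close>, so a neighbour outside the run exists on both
    sides and differs from the apex.\<close>
  define I where "I = {p (a - 1), p (b + 1)}"
  have ne: "p k \<noteq> p l" if "k < l" "l < card C" for k l
    using inj_on_contraD[OF inj, of k l] that by auto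
  have WI: "W a b \<inter> I = {}"
  proof (rule equals0I)
    fix x assume "x \<in> W a b \<inter> I"
    then have "x = p 0 \<or> x \<in> p ` {a..b}" and I: "x = p (a - 1) \<or> x = p (b + 1)"
      unfolding W_def I_def by simp_all
    then have "x \<in> p ` insert 0 {a..b}" by blast
    then obtain k where "x = p k" "k \<in> insert 0 {a..b}" by (rule imageE)
    then have k: "x = p k" "k = 0 \<or> a \<le> k \<and> k \<le> b" by simp_all
    have "k < card C" "a - 1 < card C" "b + 1 < card C" "k \<noteq> a - 1" "k \<noteq> b + 1"
      using k(2) ab by linarith+
    then have "p k \<noteq> p (a - 1)" "p k \<noteq> p (b + 1)"
      using inj_on_eq_iff[OF inj] by simp_all
    then show False using I k(1) by simp
  qed
  have WIC: "W a b \<union> I \<subseteq> C" using bij_betwE[OF p] ab by (auto simp: W_def I_def)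
  \<comment> \<open>The positions \<open>0 < a - 1 < a < b + 1\<close> interleave, so the first
    bounding diagonal already separates the two new tips.\<close>
  have "closed_segment (p 0) (p a) \<inter> closed_segment (p (a - 1)) (p (b + 1)) \<noteq> {}"
    using ab by (intro alt) auto
  moreover have "closed_segment (p 0) (p a) \<subseteq> convex hull W a b"
    using ab by (intro closed_segment_subset hull_inc) (auto simp: W_def)
  ultimately have meet: "closed_segment (p (a - 1)) (p (b + 1)) \<inter> convex hull W a b \<noteq> {}" by blast
  have sep: "pairwise_separated (convex hull W a b) I"
    unfolding pairwise_separated_def
  proof (intro ballI impI)
    fix u v assume "u \<in> I" "v \<in> I" "u \<noteq> v"
    then have "u = p (a - 1) \<and> v = p (b + 1) \<or> v = p (a - 1) \<and> u = p (b + 1)"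
      unfolding I_def by auto
    then have "closed_segment u v = closed_segment (p (a - 1)) (p (b + 1))"
      using closed_segment_commute[of u v] by metis
    then show "closed_segment u v \<inter> convex hull W a b \<noteq> {}" using meet by metis
  qed
  have sub: "W a b \<union> I \<subseteq> X" "convex_position (W a b \<union> I)"
    using WIC C convex_position_subset by blast+
  obtain S where S: "S \<subseteq> X" "convex_position S" "card S = card (W a b) + card I" "excess X S = excess X (W a b)"
    by (rule replace_ears[OF X(1) sub WI sep order_refl])
  have "card (p ` {a..b}) = b + 1 - a"
    using ab by (subst card_image) (rule inj_on_subset[OF inj], auto)
  moreover have "p 0 \<notin> p ` {a..b}"
  proof
    assume "p 0 \<in> p ` {a..b}"
    then obtain k where "p 0 = p k" "k \<in> {a..b}" by (rule imageE)
    moreover from this have "0 < k" "k < card C" using ab by simp_all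
    ultimately show False using ne[of 0 k] by simp
  qed
  ultimately have "card (W a b) = b + 2 - a" using ab by (simp add: W_def)
  moreover have "card I = 2" unfolding I_def using ne[of "a - 1" "b + 1"] ab by simp
  \<comment> \<open>The run contributes at least \<open>M + 1\<close> vertices, the apex one more
    and the substituted tips two.\<close>
  ultimately have "M + 4 \<le> card S" using S(3) ab by simp
  then show ?thesis using S dvd by auto
qed

theorem mainTheorem7:
  fixes n q :: nat
  assumes "q \<ge> 2" and "n \<ge> 2 * q - 1"
  shows "h_mod_prop n q (g (q * (n - 4) + 4)) \<and>
         (\<exists>k>0. h_mod_prop n q k) \<and>
         h_mod n q \<le> g (q * (n - 4) + 4)"
proof -
  let ?k = "g (q * (n - 4) + 4)"
  have q: "q > 0" using assms by simp
  have h: "h_mod_prop n q ?k"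
    unfolding h_mod_prop_def
  proof (intro allI impI)
    fix X :: "point set" assume X: "finite X \<and> general_position X \<and> ?k \<le> card X"
    then have X': "finite X" "general_position X" by auto
    obtain C where C: "C \<subseteq> X" "convex_position C" "card C = q * (n - 4) + 4"
      using g_spec(2)[OF X'] X by blast
    obtain S where S: "S \<subseteq> X" "convex_position S" "n - 4 + 4 \<le> card S" "int q dvd excess X S"
      using exists_large_divisible_polygon[OF X' C q] by blast
    \<comment> \<open>For \<open>n = 3\<close> the truncated difference \<open>n - 4\<close> is 0,
      and four vertices are still enough.\<close>
    have "n \<le> card S" using S(3) by simp
    then obtain T where T: "T \<subseteq> X" "convex_position T" "card T = n" "int q dvd excess X T"
      using reduce_to_size[OF X' S(1,2,4) q assms(2)] by blast
    have "q dvd interior_count X T"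
      using T(4) interior_count_eq_excess[OF X' T(1,2)] by (metis int_dvd_int_iff)
    then show "\<exists>C\<subseteq>X. card C = n \<and> convex_position C \<and> q dvd interior_count X C" using T by blast
  qed
  have k: "?k > 0" by (rule g_spec(1))
  moreover have "h_mod n q \<le> ?k" unfolding h_mod_def by (rule Least_le) (use h k in blast)
  ultimately show ?thesis using h by blast
qed

end
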